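(* Let $\Pi=\{\pi_1,\dots,\pi_m\}$ be a finite class of candidate policies with values $\nu(\pi)\in[0,1]$, and let $\Pi^\star=\{\pi\in\Pi:\nu(\pi)=\max_{\pi'\in\Pi}\nu(\pi')\}$. Fix $\alpha\in(0,1)$ and, for each $\pi\in\Pi$, let $\left[L_t\!\left(\pi;\frac{\alpha}{m}\right),U_t\!\left(\pi;\frac{\alpha}{m}\right)\right]_{t\ge1}$ be a $(1-\alpha/m)$ confidence sequence for $\nu(\pi)$ constructed from the logged contextual bandit data. For each integer $t\ge1$ define $$S_t:=\left\{\pi\in\Pi:\ U_t\!\left(\pi;\tfrac{\alpha}{m}\right)\ \ge\ \max_{\pi'\in\Pi}L_t\!\left(\pi';\tfrac{\alpha}{m}\right)\right\}.$$ Then $$\mathbb{P}\left(\Pi^\star\subseteq S_t\ \text{ for all } t\ge1\right)\ \ge\ 1-\alpha.$$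
   Context: Contextual bandit data: a sequence $(X_t,A_t,R_t)_{t\ge1}$ of contexts $X_t\in\mathcal X$, actions $A_t\in\mathcal A$ and rewards $R_t\in[0,1]$ is observed, with natural filtration $\mathcal H_t=\sigma((X_i,A_i,R_i)_{i=1}^t)$. Actions are drawn from a predictable sequence of logging policies: $A_t\mid(X_t,\mathcal H_{t-1})\sim h_t(\cdot\mid X_t)$, where $h_t$ is $\mathcal H_{t-1}$-measurable. A policy $\pi(a\mid x)$ is a conditional distribution over actions given the context; every $\pi\in\Pi$ is absolutely continuous with respect to $h_t$ for all $t$. Policy values: $\nu_t(\pi):=\mathbb E_\pi[R_t\mid\mathcal H_{t-1}]$ is the conditional expected reward under the counterfactual intervention that draws $A_t$ from $\pi(\cdot\mid X_t)$ rather than from $h_t(\cdot\mid X_t)$. Policy values are time-invariant: for each $\pi\in\Pi$ there is a constant $\nu(\pi)\in[0,1]$ with $\nu_t(\pi)=\nu(\pi)$ for all $t\ge1$. Confidence sequence: a sequence of random intervals $[L_t,U_t]_{t\ge1}$ is a $(1-\beta)$ confidence sequence for a parameter $\theta$ if $\mathbb P(\theta\in[L_t,U_t]\ \text{for all } t\ge1)\ge1-\beta$. *)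

theory Defs
  imports "HOL-Probability.Probability"
begin

type_synonym ('x, 'a) policy = "'x \<Rightarrow> 'a measure"

definition cond_distribution ::
  "'w measure \<Rightarrow> 'w measure \<Rightarrow> ('w \<Rightarrow> 'b) \<Rightarrow> 'b measure \<Rightarrow> ('w \<Rightarrow> 'b measure) \<Rightarrow> bool"
where
  "cond_distribution M F Y N K \<longleftrightarrow>
     Y \<in> M \<rightarrow>\<^sub>M N \<and> K \<in> F \<rightarrow>\<^sub>M prob_algebra N \<and>
     (\<forall>B\<in>sets N. AE \<omega> in M.
        real_cond_exp M F (indicator (Y -` B \<inter> space M)) \<omega> = measure (K \<omega>) B)"

text \<open>Rounds are numbered from 1; the values of the data at index 0 are irrelevant, and
  the history at time 0 is the trivial sigma-algebra.\<close>

definition history ::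
  "'w measure \<Rightarrow> 'x measure \<Rightarrow> 'a measure \<Rightarrow> (nat \<Rightarrow> 'w \<Rightarrow> 'x) \<Rightarrow> (nat \<Rightarrow> 'w \<Rightarrow> 'a) \<Rightarrow>
   (nat \<Rightarrow> 'w \<Rightarrow> real) \<Rightarrow> nat \<Rightarrow> 'w measure"
where
  "history M MX MA X A R t =
     vimage_algebra (space M) (\<lambda>\<omega>. \<lambda>i\<in>{1..t}. (X i \<omega>, A i \<omega>, R i \<omega>))
       (Pi\<^sub>M {1..t} (\<lambda>_. MX \<Otimes>\<^sub>M MA \<Otimes>\<^sub>M borel))"

text \<open>Logged contextual bandit data. The kernel \<open>h t \<omega>\<close> is the logging policy of round \<open>t\<close>, and
  \<open>P t \<omega> x a\<close> is the conditional law of the reward of round \<open>t\<close> given the past, the context \<open>x\<close>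
  and the action \<open>a\<close>. Both depend on \<open>\<omega>\<close> only through the history up to time \<open>t - 1\<close>.
  Pulling back along \<open>\<lambda>\<omega>. (\<omega>, X t \<omega>)\<close> yields the sigma-algebra generated by the history
  together with \<open>X t\<close>, and similarly for \<open>(X t, A t)\<close>. As rewards are real-valued, a kernel \<open>P\<close>
  with the stated properties exists for any such data; it is unique up to null sets of the logging
  law, which are also null sets for every policy that is absolutely continuous with respect to \<open>h\<close>.\<close>

locale contextual_bandit = prob_space M
  for M :: "'w measure"
  and MX :: "'x measure" and MA :: "'a measure"
  and X :: "nat \<Rightarrow> 'w \<Rightarrow> 'x" and A :: "nat \<Rightarrow> 'w \<Rightarrow> 'a" and R :: "nat \<Rightarrow> 'w \<Rightarrow> real"
  and h :: "nat \<Rightarrow> 'w \<Rightarrow> ('x, 'a) policy"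
  and P :: "nat \<Rightarrow> 'w \<Rightarrow> 'x \<Rightarrow> 'a \<Rightarrow> real measure" +
  assumes context_measurable: "\<And>t. 1 \<le> t \<Longrightarrow> X t \<in> M \<rightarrow>\<^sub>M MX"
    and action_measurable: "\<And>t. 1 \<le> t \<Longrightarrow> A t \<in> M \<rightarrow>\<^sub>M MA"
    and reward_measurable: "\<And>t. 1 \<le> t \<Longrightarrow> R t \<in> borel_measurable M"
    and reward_bounded: "\<And>t \<omega>. 1 \<le> t \<Longrightarrow> \<omega> \<in> space M \<Longrightarrow> R t \<omega> \<in> {0..1}"
    and logging_predictable: "\<And>t. 1 \<le> t \<Longrightarrow>
      (\<lambda>(\<omega>, x). h t \<omega> x) \<in> history M MX MA X A R (t - 1) \<Otimes>\<^sub>M MX \<rightarrow>\<^sub>M prob_algebra MA"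
    and action_law: "\<And>t. 1 \<le> t \<Longrightarrow>
      cond_distribution M
        (vimage_algebra (space M) (\<lambda>\<omega>. (\<omega>, X t \<omega>)) (history M MX MA X A R (t - 1) \<Otimes>\<^sub>M MX))
        (A t) MA (\<lambda>\<omega>. h t \<omega> (X t \<omega>))"
    and reward_kernel: "\<And>t. 1 \<le> t \<Longrightarrow>
      (\<lambda>(\<omega>, x, a). P t \<omega> x a)
        \<in> history M MX MA X A R (t - 1) \<Otimes>\<^sub>M MX \<Otimes>\<^sub>M MA \<rightarrow>\<^sub>M prob_algebra borel"
    and reward_law: "\<And>t. 1 \<le> t \<Longrightarrow>
      cond_distribution M
        (vimage_algebra (space M) (\<lambda>\<omega>. (\<omega>, X t \<omega>, A t \<omega>))
          (history M MX MA X A R (t - 1) \<Otimes>\<^sub>M MX \<Otimes>\<^sub>M MA))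
        (R t) borel (\<lambda>\<omega>. P t \<omega> (X t \<omega>) (A t \<omega>))"

text \<open>The law of \<open>(\<omega>, a, r)\<close> when, in round \<open>t\<close>, the past and the context \<open>X t \<omega>\<close> are generated as
  before, but the action \<open>a\<close> is drawn from the policy \<open>\<pi>\<close> instead of the logging policy and the
  reward \<open>r\<close> then follows the unchanged reward mechanism.\<close>

definition intervention ::
  "'w measure \<Rightarrow> 'a measure \<Rightarrow> (nat \<Rightarrow> 'w \<Rightarrow> 'x) \<Rightarrow> (nat \<Rightarrow> 'w \<Rightarrow> 'x \<Rightarrow> 'a \<Rightarrow> real measure) \<Rightarrow>
   nat \<Rightarrow> ('x, 'a) policy \<Rightarrow> ('w \<times> 'a \<times> real) measure"
where
  "intervention M MA X P t \<pi> =
     do {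
       \<omega> \<leftarrow> M;
       a \<leftarrow> \<pi> (X t \<omega>);
       r \<leftarrow> P t \<omega> (X t \<omega>) a;
       return (M \<Otimes>\<^sub>M MA \<Otimes>\<^sub>M borel) (\<omega>, a, r)
     }"

text \<open>The conditional expectation of the reward given the history up to time \<open>t - 1\<close>, under
  the intervention.\<close>

definition policy_value_at ::
  "'w measure \<Rightarrow> 'x measure \<Rightarrow> 'a measure \<Rightarrow> (nat \<Rightarrow> 'w \<Rightarrow> 'x) \<Rightarrow> (nat \<Rightarrow> 'w \<Rightarrow> 'a) \<Rightarrow>
   (nat \<Rightarrow> 'w \<Rightarrow> real) \<Rightarrow> (nat \<Rightarrow> 'w \<Rightarrow> 'x \<Rightarrow> 'a \<Rightarrow> real measure) \<Rightarrow>
   nat \<Rightarrow> ('x, 'a) policy \<Rightarrow> 'w \<times> 'a \<times> real \<Rightarrow> real"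
where
  "policy_value_at M MX MA X A R P t \<pi> =
     real_cond_exp (intervention M MA X P t \<pi>)
       (vimage_algebra (space (intervention M MA X P t \<pi>)) fst (history M MX MA X A R (t - 1)))
       (\<lambda>(\<omega>, a, r). r)"

locale off_policy_bandit = contextual_bandit M MX MA X A R h P
  for M :: "'w measure"
  and MX :: "'x measure" and MA :: "'a measure"
  and X :: "nat \<Rightarrow> 'w \<Rightarrow> 'x" and A :: "nat \<Rightarrow> 'w \<Rightarrow> 'a" and R :: "nat \<Rightarrow> 'w \<Rightarrow> real"
  and h :: "nat \<Rightarrow> 'w \<Rightarrow> ('x, 'a) policy"
  and P :: "nat \<Rightarrow> 'w \<Rightarrow> 'x \<Rightarrow> 'a \<Rightarrow> real measure"
  and Pols :: "('x, 'a) policy set" and \<nu> :: "('x, 'a) policy \<Rightarrow> real" +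
  assumes policy_kernel: "\<And>\<pi>. \<pi> \<in> Pols \<Longrightarrow> \<pi> \<in> MX \<rightarrow>\<^sub>M prob_algebra MA"
    and policy_absolutely_continuous: "\<And>\<pi> t \<omega> x. \<pi> \<in> Pols \<Longrightarrow> 1 \<le> t \<Longrightarrow> \<omega> \<in> space M \<Longrightarrow>
      x \<in> space MX \<Longrightarrow> absolutely_continuous (h t \<omega> x) (\<pi> x)"
    and value_time_invariant: "\<And>\<pi> t. \<pi> \<in> Pols \<Longrightarrow> 1 \<le> t \<Longrightarrow>
      AE z in intervention M MA X P t \<pi>. policy_value_at M MX MA X A R P t \<pi> z = \<nu> \<pi>"
    and value_bounded: "\<And>\<pi>. \<pi> \<in> Pols \<Longrightarrow> \<nu> \<pi> \<in> {0..1}"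

definition confidence_sequence ::
  "'w measure \<Rightarrow> real \<Rightarrow> real \<Rightarrow> (nat \<Rightarrow> 'w \<Rightarrow> real) \<Rightarrow> (nat \<Rightarrow> 'w \<Rightarrow> real) \<Rightarrow> bool"
where
  "confidence_sequence M \<beta> \<theta> L U \<longleftrightarrow>
     (\<forall>t\<ge>1. L t \<in> borel_measurable M \<and> U t \<in> borel_measurable M) \<and>
     measure M {\<omega> \<in> space M. \<forall>t\<ge>1. \<theta> \<in> {L t \<omega>..U t \<omega>}} \<ge> 1 - \<beta>"

definition optimal_policies :: "'p set \<Rightarrow> ('p \<Rightarrow> real) \<Rightarrow> 'p set" where
  "optimal_policies Pols \<nu> = {\<pi> \<in> Pols. \<nu> \<pi> = Max (\<nu> ` Pols)}"

text \<open>The bounds \<open>L t \<pi> \<beta>\<close> and \<open>U t \<pi> \<beta>\<close> carry their error level \<open>\<beta>\<close> as an argument.\<close>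

definition surviving_policies ::
  "'p set \<Rightarrow> (nat \<Rightarrow> 'p \<Rightarrow> real \<Rightarrow> 'w \<Rightarrow> real) \<Rightarrow> (nat \<Rightarrow> 'p \<Rightarrow> real \<Rightarrow> 'w \<Rightarrow> real) \<Rightarrow>
   real \<Rightarrow> nat \<Rightarrow> 'w \<Rightarrow> 'p set"
where
  "surviving_policies Pols L U \<beta> t \<omega> =
     {\<pi> \<in> Pols. U t \<pi> \<beta> \<omega> \<ge> Max ((\<lambda>\<pi>'. L t \<pi>' \<beta> \<omega>) ` Pols)}"

end

theory Submission
  imports Defs
begin

text \<open>On the event that every interval covers its parameter at all times, which fails with
  probability at most \<open>\<alpha>\<close> by the union bound, the upper bound of an optimal policy is at least the
  maximal value and hence at least the lower bound of every other policy.\<close>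

text \<open>The complement form of coverage, prepared for the union bound. Measurability is proved
  alongside the bound because both the complement rule and subadditivity require measurable
  events.\<close>

lemma confidence_sequence_miscoverage:
  assumes "prob_space M" and "confidence_sequence M \<beta> \<theta> L U"
  shows "{\<omega> \<in> space M. \<not> (\<forall>t\<ge>1. \<theta> \<in> {L t \<omega>..U t \<omega>})} \<in> sets M"
    and "measure M {\<omega> \<in> space M. \<not> (\<forall>t\<ge>1. \<theta> \<in> {L t \<omega>..U t \<omega>})} \<le> \<beta>"
proof -
  interpret prob_space M by fact
  let ?C = "{\<omega> \<in> space M. \<forall>t\<ge>1. \<theta> \<in> {L t \<omega>..U t \<omega>}}"
  let ?N = "{\<omega> \<in> space M. \<not> (\<forall>t\<ge>1. \<theta> \<in> {L t \<omega>..U t \<omega>})}"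
  have [measurable]: "L t \<in> borel_measurable M" "U t \<in> borel_measurable M" if "t \<in> {1..}" for t
    using assms(2) that by (auto simp: confidence_sequence_def)
  \<comment> \<open>The quantifier is bounded by the countable set \<open>{1..}\<close>:
    measurability of the bounds is available only from time 1 on, and the event is a countable
    intersection over these times.\<close>
  have "{\<omega> \<in> space M. \<forall>t\<in>{1..}. L t \<omega> \<le> \<theta> \<and> \<theta> \<le> U t \<omega>} \<in> sets M"
    by (intro sets.sets_Collect_countable_All') auto
  then have C: "?C \<in> sets M"
    by (simp add: Ball_def)
  have N: "?N = space M - ?C"
    by auto
  show "?N \<in> sets M"
    unfolding N using C by blast
  show "measure M ?N \<le> \<beta>"
    unfolding N prob_compl[OF C] using assms(2) by (simp add: confidence_sequence_def)
qed

text \<open>A union bound over the miscoverage events \<open>N i\<close>. It holds under arbitrary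
  dependence, which matters since the sequences of all policies are built from the same
  data.\<close>

lemma confidence_sequences_simultaneous:
  assumes "prob_space M" and "finite I"
    and "\<And>i. i \<in> I \<Longrightarrow> confidence_sequence M \<beta> (\<theta> i) (\<lambda>t. L t i) (\<lambda>t. U t i)"
  shows "measure M {\<omega> \<in> space M. \<forall>i\<in>I. \<forall>t\<ge>1. \<theta> i \<in> {L t i \<omega>..U t i \<omega>}}
    \<ge> 1 - real (card I) * \<beta>"
proof -
  interpret prob_space M by fact
  define N where "N i = {\<omega> \<in> space M. \<not> (\<forall>t\<ge>1. \<theta> i \<in> {L t i \<omega>..U t i \<omega>})}" for i
  have N: "N i \<in> sets M" "prob (N i) \<le> \<beta>" if "i \<in> I" for i
    unfolding N_def
    by (rule confidence_sequence_miscoverage[OF assms(1) assms(3)[OF that]])+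
  have "prob (\<Union>i\<in>I. N i) \<le> (\<Sum>i\<in>I. prob (N i))"
    using assms(2) N(1) by (intro finite_measure_subadditive_finite) blast+
  also have "\<dots> \<le> real (card I) * \<beta>"
    using N(2) by (rule sum_bounded_above)
  finally have "1 - real (card I) * \<beta> \<le> 1 - prob (\<Union>i\<in>I. N i)"
    by simp
  also have "\<dots> = prob (space M - (\<Union>i\<in>I. N i))"
    using assms(2) N(1) by (intro prob_compl[symmetric] sets.finite_UN)
  also have "space M - (\<Union>i\<in>I. N i)
      = {\<omega> \<in> space M. \<forall>i\<in>I. \<forall>t\<ge>1. \<theta> i \<in> {L t i \<omega>..U t i \<omega>}}"
    unfolding N_def by blast
  finally show ?thesis .
qed

text \<open>The deterministic core, with \<open>t\<close> and \<omega> fixed: any two policies are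
  compared through their true values, so that only coverage remains to be handled by
  probability.\<close>

lemma optimal_policies_survive:
  assumes "finite Pols"
    and "\<And>\<pi>. \<pi> \<in> Pols \<Longrightarrow> \<nu> \<pi> \<in> {L t \<pi> \<beta> \<omega>..U t \<pi> \<beta> \<omega>}"
  shows "optimal_policies Pols \<nu> \<subseteq> surviving_policies Pols L U \<beta> t \<omega>"
proof
  fix \<pi> assume "\<pi> \<in> optimal_policies Pols \<nu>"
  then have \<pi>: "\<pi> \<in> Pols" and max: "\<nu> \<pi> = Max (\<nu> ` Pols)"
    by (auto simp: optimal_policies_def)
  have "L t \<pi>' \<beta> \<omega> \<le> U t \<pi> \<beta> \<omega>" if "\<pi>' \<in> Pols" for \<pi>'
  proof -
    have "L t \<pi>' \<beta> \<omega> \<le> \<nu> \<pi>'"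
      using assms(2)[OF that] by simp
    also have "\<dots> \<le> \<nu> \<pi>"
      unfolding max using assms(1) that by simp
    also have "\<dots> \<le> U t \<pi> \<beta> \<omega>"
      using assms(2)[OF \<pi>] by simp
    finally show ?thesis .
  qed
  then show "\<pi> \<in> surviving_policies Pols L U \<beta> t \<omega>"
    \<comment> \<open>The maximum in the definition ranges over a nonempty set, as \<pi> itself
      belongs to \<open>Pols\<close>; hence bounding each lower bound separately is enough.\<close>
    using assms(1) \<pi> by (subst surviving_policies_def, subst mem_Collect_eq, subst Max_le_iff) auto
qed

theorem theorem1:
  fixes M :: "'w measure" and MX :: "'x measure" and MA :: "'a measure"
    and X :: "nat \<Rightarrow> 'w \<Rightarrow> 'x" and A :: "nat \<Rightarrow> 'w \<Rightarrow> 'a" and R :: "nat \<Rightarrow> 'w \<Rightarrow> real"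
    and h :: "nat \<Rightarrow> 'w \<Rightarrow> ('x, 'a) policy"
    and P :: "nat \<Rightarrow> 'w \<Rightarrow> 'x \<Rightarrow> 'a \<Rightarrow> real measure"
    and m :: nat and p :: "nat \<Rightarrow> ('x, 'a) policy"
    and Pols :: "('x, 'a) policy set" and \<nu> :: "('x, 'a) policy \<Rightarrow> real"
    and \<alpha> :: real
    and L U :: "nat \<Rightarrow> ('x, 'a) policy \<Rightarrow> real \<Rightarrow> 'w \<Rightarrow> real"
  assumes "1 \<le> m" and "Pols = p ` {1..m}"
    and "off_policy_bandit M MX MA X A R h P Pols \<nu>"
    and "0 < \<alpha>" and "\<alpha> < 1"
    and "\<And>\<pi> t. \<pi> \<in> Pols \<Longrightarrow> 1 \<le> t \<Longrightarrow>
           L t \<pi> (\<alpha> / real m) \<in> borel_measurable (history M MX MA X A R t) \<and>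
           U t \<pi> (\<alpha> / real m) \<in> borel_measurable (history M MX MA X A R t)"
    and "\<And>\<pi>. \<pi> \<in> Pols \<Longrightarrow>
           confidence_sequence M (\<alpha> / real m) (\<nu> \<pi>)
             (\<lambda>t. L t \<pi> (\<alpha> / real m)) (\<lambda>t. U t \<pi> (\<alpha> / real m))"
  shows "measure M {\<omega> \<in> space M. \<forall>t\<ge>1.
           optimal_policies Pols \<nu> \<subseteq> surviving_policies Pols L U (\<alpha> / real m) t \<omega>} \<ge> 1 - \<alpha>"
proof -
  interpret off_policy_bandit M MX MA X A R h P Pols \<nu>
    by fact
  let ?\<beta> = "\<alpha> / real m"
  let ?C = "{\<omega> \<in> space M. \<forall>\<pi>\<in>Pols. \<forall>t\<ge>1. \<nu> \<pi> \<in> {L t \<pi> ?\<beta> \<omega>..U t \<pi> ?\<beta> \<omega>}}"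
  let ?S = "{\<omega> \<in> space M. \<forall>t\<ge>1. optimal_policies Pols \<nu> \<subseteq> surviving_policies Pols L U ?\<beta> t \<omega>}"
  have fin: "finite Pols" and ne: "Pols \<noteq> {}"
    using assms(1,2) by auto
  have [measurable]: "L t \<pi> ?\<beta> \<in> borel_measurable M" "U t \<pi> ?\<beta> \<in> borel_measurable M"
    if "\<pi> \<in> Pols" "1 \<le> t" for \<pi> t
    using assms(7)[OF that(1)] that(2) by (auto simp: confidence_sequence_def)
  \<comment> \<open>Only an inequality, since \<open>p\<close> may list a policy twice. It suffices
    because the level \<open>\<alpha> / real m\<close> is positive.\<close>
  have "card Pols \<le> m"
    using card_image_le[of "{1..m}" p] assms(2) by simp
  then have "real (card Pols) * ?\<beta> \<le> \<alpha>"
    using assms(1,4) by (simp add: field_simps)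
  then have "1 - \<alpha> \<le> 1 - real (card Pols) * ?\<beta>"
    by simp
  also have "\<dots> \<le> prob ?C"
    using confidence_sequences_simultaneous[OF prob_space_axioms fin assms(7)] .
  also have "\<dots> \<le> prob ?S"
  proof (rule finite_measure_mono)
    show "?C \<subseteq> ?S"
      by (intro subsetI CollectI conjI allI impI optimal_policies_survive[OF fin]) auto
    \<comment> \<open>Monotonicity of \<open>prob\<close> requires the larger event to be
      measurable. Replacing the maximum by pairwise comparisons of bounds exhibits \<open>?S\<close>
      as a countable intersection of measurable events.\<close>
    have "?S = {\<omega> \<in> space M. \<forall>t\<in>{1..}. \<forall>\<pi>\<in>optimal_policies Pols \<nu>. \<forall>\<pi>'\<in>Pols.
        L t \<pi>' ?\<beta> \<omega> \<le> U t \<pi> ?\<beta> \<omega>}"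
      using fin ne by (auto simp: surviving_policies_def optimal_policies_def subset_iff)
    also have "\<dots> \<in> sets M"
    proof (intro sets.sets_Collect_countable_All')
      have sub: "optimal_policies Pols \<nu> \<subseteq> Pols"
        by (auto simp: optimal_policies_def)
      then show "countable (optimal_policies Pols \<nu>)"
        using fin by (intro countable_finite) (rule finite_subset)
      show "{\<omega> \<in> space M. L t \<pi>' ?\<beta> \<omega> \<le> U t \<pi> ?\<beta> \<omega>} \<in> sets M"
        if "t \<in> {1..}" "\<pi> \<in> optimal_policies Pols \<nu>" "\<pi>' \<in> Pols" for t \<pi> \<pi>'
        using that sub by auto
    qed (use fin in \<open>auto intro: countable_finite\<close>)
    finally show "?S \<in> sets M" .
  qed
  finally show ?thesis .
qed

end
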